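(* Let $n\ge1$, let $a=v_0<v_1<\dots<v_n=b$, let $\zeta_i\in(v_i,v_{i+1})$ for $0\le i\le n-1$, and let $\varphi(i)\ge 2$ be integers for $0\le i\le n$. For $p\in\mathbb{P}_{\varphi,\overline{\tau}_n}$ define $$\mathcal{Q}_{\varphi,\overline{\tau}_n}p=\sum_{i=0}^{n}\ \sum_{|\alpha|=\varphi(i)-1}\mathbf{B}\bigl[p_i\bigr]\bigl(v_i,\zeta_{i-1}[\alpha_1],\zeta_i[\alpha_2]\bigr)\,\mathcal{N}_{i,\alpha},$$ where $p_i\in\mathbb{P}_{\varphi(i)}$ is the polynomial piece of $p$ on $[v_i,\zeta_i]$ (for $i=n$: on $[\zeta_{n-1},v_n]$) and $\mathbf{B}[p_i]$ is its blossom as a polynomial of degree $\varphi(i)$. Then $\mathcal{Q}_{\varphi,\overline{\tau}_n}p\in\mathcal{S}^1(\varphi,\overline{\tau}_n)$ for all $p\in\mathbb{P}_{\varphi,\overline{\tau}_n}$, and $\mathcal{Q}_{\varphi,\overline{\tau}_n}\tilde p=\tilde p$ on $[a,b]$ for all $\tilde p\in\mathbb{P}_{\min_{0\le i\le n}\varphi(i)}$.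
   Context: Put $\zeta_{-1}=v_0$, $\zeta_n=v_n$. $\mathbb{P}_d$ is the space of real polynomials of degree $\le d$. $\mathbb{P}_{\varphi,\overline{\tau}_n}$ is the space of piecewise polynomials $p$ on $[a,b]$ whose pieces on $[\zeta_{i-1},v_i]$ and on $[v_i,\zeta_i]$ (when non-degenerate) are in $\mathbb{P}_{\varphi(i)}$, $0\le i\le n$ (no smoothness required). The space $\mathcal{S}^1(\varphi,\overline{\tau}_n)$ consists of all functions $s:[a,b]\to\mathbb{R}$ such that: (i) for each $0\le i\le n$, the restrictions of $s$ to $[\zeta_{i-1},v_i]$ and to $[v_i,\zeta_i]$ (when non-degenerate) are in $\mathbb{P}_{\varphi(i)}$; (ii) $s$ is $\mathcal{C}^{\varphi(i)-1}$ at $v_i$ for $0<i<n$; (iii) $s$ is $\mathcal{C}^1$ at $\zeta_i$ for $0\le i\le n-1$ ("$\mathcal{C}^r$ at a point" means that the derivatives of orders $0,\dots,r$ of the two adjacent polynomial pieces agree there). A function $s\in\mathcal{S}^1(\varphi,\overline{\tau}_n)$ exists and is unique with arbitrarily prescribed values $s^{(j)}(v_i)$, $0\le i\le n$, $0\le j\le\varphi(i)-1$ (one-sided derivatives at $a$, $b$). For $p\in\mathbb{P}_d$, the blossom $\mathbf{B}[p]:\mathbb{R}^d\to\mathbb{R}$ (of $p$ as a polynomial of degree $d$) is the unique symmetric function, affine in each argument, with $\mathbf{B}[p](v,\dots,v)=p(v)$. The notation $v[\ell]$ means that the argument $v$ is repeated $\ell$ times. For a multi-index $\alpha=(\alpha_1,\alpha_2)\in\mathbb{Z}_{\ge0}^2$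 with $|\alpha|=\alpha_1+\alpha_2=d$ and an interval $[A,B]$, the Bernstein polynomial is $\mathfrak{B}^d_{\alpha,[A,B]}(v)=\frac{d!}{\alpha_1!\alpha_2!}\frac{(B-v)^{\alpha_1}(v-A)^{\alpha_2}}{(B-A)^d}$. For $0\le i\le n$ let $\theta_i=\frac{\varphi(i)-1}{\varphi(i)}$, $S_{i,1}=\theta_i\zeta_{i-1}+(1-\theta_i)v_i$, $S_{i,2}=\theta_i\zeta_i+(1-\theta_i)v_i$, and $S_i=[S_{i,1},S_{i,2}]$ (so $S_{0,1}=v_0$ and $S_{n,2}=v_n$). For $|\alpha|=\varphi(i)-1$ and $0\le j\le\varphi(i)-1$ set $$\gamma_{i,\alpha}^j=\frac{\binom{\varphi(i)}{j}}{\binom{\varphi(i)-1}{j}}\,\theta_i^j\,\bigl(\mathfrak{B}^{\varphi(i)-1}_{\alpha,S_i}\bigr)^{(j)}(v_i).$$ The B-spline-like function $\mathcal{N}_{i,\alpha}$ is the unique element of $\mathcal{S}^1(\varphi,\overline{\tau}_n)$ with $\mathcal{N}_{i,\alpha}^{(j)}(v_i)=\gamma_{i,\alpha}^j$ for $0\le j\le\varphi(i)-1$ and $\mathcal{N}_{i,\alpha}^{(j)}(v_k)=0$ for $k\ne i$, $0\le j\le\varphi(k)-1$. *)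

theory Defs
  imports Complex_Main "HOL-Library.FuncSet" "HOL-Library.Multiset"
    "HOL-Computational_Algebra.Polynomial"
begin

text \<open>
  Throughout, functions on an interval \<open>[a,b]\<close> are elements of \<open>{a..b} \<rightarrow>\<^sub>E UNIV\<close>, so that equality of
  such functions is equality on \<open>[a,b]\<close>. The data are the vertices \<open>v 0 < \<dots> < v n\<close>, the split points
  \<open>\<zeta> i\<close> for \<open>i < n\<close>, and the degrees \<open>\<phi> i\<close>.
\<close>

definition polys_upto :: "nat \<Rightarrow> real poly set" where
  "polys_upto d = {q. degree q \<le> d}"

text \<open>Only meaningful if \<open>A < B\<close> and \<open>s\<close> is polynomial on the open interval.\<close>

definition piece :: "(real \<Rightarrow> real) \<Rightarrow> real \<Rightarrow> real \<Rightarrow> real poly" where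
  "piece s A B = (THE q. \<forall>x\<in>{A<..<B}. s x = poly q x)"

definition agree_at :: "nat \<Rightarrow> real poly \<Rightarrow> real poly \<Rightarrow> real \<Rightarrow> bool" where
  "agree_at r p q x \<longleftrightarrow> (\<forall>j\<le>r. poly ((pderiv ^^ j) p) x = poly ((pderiv ^^ j) q) x)"

text \<open>\<open>zeta_left v \<zeta> i\<close> is \<open>\<zeta>\<^sub>i\<^sub>-\<^sub>1\<close> with \<open>\<zeta>\<^sub>-\<^sub>1 = v\<^sub>0\<close>; \<open>zeta_right n v \<zeta> i\<close> is \<open>\<zeta>\<^sub>i\<close> with \<open>\<zeta>\<^sub>n = v\<^sub>n\<close>.\<close>

definition zeta_left :: "(nat \<Rightarrow> real) \<Rightarrow> (nat \<Rightarrow> real) \<Rightarrow> nat \<Rightarrow> real" where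
  "zeta_left v \<zeta> i = (if i = 0 then v 0 else \<zeta> (i - 1))"

definition zeta_right :: "nat \<Rightarrow> (nat \<Rightarrow> real) \<Rightarrow> (nat \<Rightarrow> real) \<Rightarrow> nat \<Rightarrow> real" where
  "zeta_right n v \<zeta> i = (if i = n then v n else \<zeta> i)"

text \<open>
  The elements of \<open>pw_polys\<close> may jump at the breakpoints, so the pieces are read off on the open
  subintervals and the values at the breakpoints are arbitrary.
\<close>

definition pw_polys ::
    "nat \<Rightarrow> (nat \<Rightarrow> real) \<Rightarrow> (nat \<Rightarrow> real) \<Rightarrow> (nat \<Rightarrow> nat) \<Rightarrow> (real \<Rightarrow> real) set" where
  "pw_polys n v \<zeta> \<phi> =
    {p \<in> {v 0..v n} \<rightarrow>\<^sub>E UNIV. \<forall>i\<le>n.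
       (zeta_left v \<zeta> i < v i \<longrightarrow>
          (\<exists>q\<in>polys_upto (\<phi> i). \<forall>x\<in>{zeta_left v \<zeta> i<..<v i}. p x = poly q x)) \<and>
       (v i < zeta_right n v \<zeta> i \<longrightarrow>
          (\<exists>q\<in>polys_upto (\<phi> i). \<forall>x\<in>{v i<..<zeta_right n v \<zeta> i}. p x = poly q x))}"

definition spline_space ::
    "nat \<Rightarrow> (nat \<Rightarrow> real) \<Rightarrow> (nat \<Rightarrow> real) \<Rightarrow> (nat \<Rightarrow> nat) \<Rightarrow> (real \<Rightarrow> real) set" where
  "spline_space n v \<zeta> \<phi> =
    {s \<in> {v 0..v n} \<rightarrow>\<^sub>E UNIV.
       (\<forall>i\<le>n.
          (zeta_left v \<zeta> i < v i \<longrightarrow>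
             (\<exists>q\<in>polys_upto (\<phi> i). \<forall>x\<in>{zeta_left v \<zeta> i..v i}. s x = poly q x)) \<and>
          (v i < zeta_right n v \<zeta> i \<longrightarrow>
             (\<exists>q\<in>polys_upto (\<phi> i). \<forall>x\<in>{v i..zeta_right n v \<zeta> i}. s x = poly q x))) \<and>
       (\<forall>i. 0 < i \<and> i < n \<longrightarrow>
          agree_at (\<phi> i - 1) (piece s (\<zeta> (i - 1)) (v i)) (piece s (v i) (\<zeta> i)) (v i)) \<and>
       (\<forall>i<n. agree_at 1 (piece s (v i) (\<zeta> i)) (piece s (\<zeta> i) (v (Suc i))) (\<zeta> i))}"

definition vertex_piece ::
    "nat \<Rightarrow> (nat \<Rightarrow> real) \<Rightarrow> (nat \<Rightarrow> real) \<Rightarrow> (real \<Rightarrow> real) \<Rightarrow> nat \<Rightarrow> real poly" where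
  "vertex_piece n v \<zeta> s i =
    (if i < n then piece s (v i) (\<zeta> i) else piece s (\<zeta> (n - 1)) (v n))"

text \<open>
  \<open>s\<^sup>(\<^sup>j\<^sup>)(v\<^sub>i)\<close> for \<open>s \<in> spline_space n v \<zeta> \<phi>\<close> and \<open>j \<le> \<phi> i - 1\<close>. At an interior vertex both
  adjacent pieces give the same value; at the two endpoints this is the one-sided derivative.
\<close>

definition vertex_deriv ::
    "nat \<Rightarrow> (nat \<Rightarrow> real) \<Rightarrow> (nat \<Rightarrow> real) \<Rightarrow> (real \<Rightarrow> real) \<Rightarrow> nat \<Rightarrow> nat \<Rightarrow> real" where
  "vertex_deriv n v \<zeta> s j i = poly ((pderiv ^^ j) (vertex_piece n v \<zeta> s i)) (v i)"

text \<open>Points of \<open>\<real>\<^sup>d\<close> are lists of length \<open>d\<close>.\<close>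

definition is_blossom :: "nat \<Rightarrow> real poly \<Rightarrow> (real list \<Rightarrow> real) \<Rightarrow> bool" where
  "is_blossom d p F \<longleftrightarrow>
     F \<in> {xs. length xs = d} \<rightarrow>\<^sub>E UNIV \<and>
     (\<forall>xs ys. length xs = d \<and> mset xs = mset ys \<longrightarrow> F xs = F ys) \<and>
     (\<forall>xs k x y t. length xs = d \<and> k < d \<longrightarrow>
        F (xs[k := (1 - t) * x + t * y]) = (1 - t) * F (xs[k := x]) + t * F (xs[k := y])) \<and>
     (\<forall>x. F (replicate d x) = poly p x)"

definition blossom :: "nat \<Rightarrow> real poly \<Rightarrow> real list \<Rightarrow> real" where
  "blossom d p = (THE F. is_blossom d p F)"

definition bernstein_poly :: "nat \<times> nat \<Rightarrow> real \<Rightarrow> real \<Rightarrow> real poly" where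
  "bernstein_poly \<alpha> A B =
    (let d = fst \<alpha> + snd \<alpha> in
       smult (fact d / (fact (fst \<alpha>) * fact (snd \<alpha>)) / (B - A) ^ d)
         ([:B, -1:] ^ fst \<alpha> * [:-A, 1:] ^ snd \<alpha>))"

definition multi_indices :: "nat \<Rightarrow> (nat \<times> nat) set" where
  "multi_indices d = {\<alpha>. fst \<alpha> + snd \<alpha> = d}"

definition theta :: "(nat \<Rightarrow> nat) \<Rightarrow> nat \<Rightarrow> real" where
  "theta \<phi> i = (real (\<phi> i) - 1) / real (\<phi> i)"

definition S_left :: "(nat \<Rightarrow> real) \<Rightarrow> (nat \<Rightarrow> real) \<Rightarrow> (nat \<Rightarrow> nat) \<Rightarrow> nat \<Rightarrow> real" where
  "S_left v \<zeta> \<phi> i = theta \<phi> i * zeta_left v \<zeta> i + (1 - theta \<phi> i) * v i"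

definition S_right ::
    "nat \<Rightarrow> (nat \<Rightarrow> real) \<Rightarrow> (nat \<Rightarrow> real) \<Rightarrow> (nat \<Rightarrow> nat) \<Rightarrow> nat \<Rightarrow> real" where
  "S_right n v \<zeta> \<phi> i = theta \<phi> i * zeta_right n v \<zeta> i + (1 - theta \<phi> i) * v i"

definition gamma_coeff ::
    "nat \<Rightarrow> (nat \<Rightarrow> real) \<Rightarrow> (nat \<Rightarrow> real) \<Rightarrow> (nat \<Rightarrow> nat) \<Rightarrow> nat \<Rightarrow> nat \<times> nat \<Rightarrow> nat \<Rightarrow> real" where
  "gamma_coeff n v \<zeta> \<phi> i \<alpha> j =
     real (\<phi> i choose j) / real ((\<phi> i - 1) choose j) * theta \<phi> i ^ j *
     poly ((pderiv ^^ j) (bernstein_poly \<alpha> (S_left v \<zeta> \<phi> i) (S_right n v \<zeta> \<phi> i))) (v i)"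

definition bspline_like ::
    "nat \<Rightarrow> (nat \<Rightarrow> real) \<Rightarrow> (nat \<Rightarrow> real) \<Rightarrow> (nat \<Rightarrow> nat) \<Rightarrow> nat \<Rightarrow> nat \<times> nat \<Rightarrow> real \<Rightarrow> real" where
  "bspline_like n v \<zeta> \<phi> i \<alpha> =
    (THE s. s \<in> spline_space n v \<zeta> \<phi> \<and>
       (\<forall>j\<le>\<phi> i - 1. vertex_deriv n v \<zeta> s j i = gamma_coeff n v \<zeta> \<phi> i \<alpha> j) \<and>
       (\<forall>k\<le>n. k \<noteq> i \<longrightarrow> (\<forall>j\<le>\<phi> k - 1. vertex_deriv n v \<zeta> s j k = 0)))"

definition quasi_interpolant ::
    "nat \<Rightarrow> (nat \<Rightarrow> real) \<Rightarrow> (nat \<Rightarrow> real) \<Rightarrow> (nat \<Rightarrow> nat) \<Rightarrow> (real \<Rightarrow> real) \<Rightarrow> real \<Rightarrow> real" where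
  "quasi_interpolant n v \<zeta> \<phi> p =
    (\<lambda>x\<in>{v 0..v n}. \<Sum>i\<le>n. \<Sum>\<alpha>\<in>multi_indices (\<phi> i - 1).
       blossom (\<phi> i) (vertex_piece n v \<zeta> p i)
         (v i # replicate (fst \<alpha>) (zeta_left v \<zeta> i) @ replicate (snd \<alpha>) (zeta_right n v \<zeta> i)) *
       bspline_like n v \<zeta> \<phi> i \<alpha> x)"

end

theory Submission
  imports Defs
begin

text \<open>
  A spline is determined by its Hermite data at the vertices: the data at \<open>v i\<close> fix both adjacent
  pieces up to a multiple of \<open>(x - v i) ^ \<phi> i\<close>, and the \<open>C\<^sup>1\<close> conditions at each split point form a
  nonsingular \<open>2 \<times> 2\<close> system for the two leading coefficients meeting there. So it suffices to compare
  Hermite data. With \<open>d = \<phi> i\<close> and \<open>B\<close> the blossom of \<open>q\<close> in degree \<open>d\<close>, the polynomial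
  \<open>G u = B (v i, u, \<dots>, u)\<close> has degree at most \<open>d - 1\<close> and Bernstein coefficients
  \<open>B (v i, \<zeta>\<^sub>i\<^sub>-\<^sub>1[\<alpha>\<^sub>1], \<zeta>\<^sub>i[\<alpha>\<^sub>2])\<close> on the interval from \<open>\<zeta>\<^sub>i\<^sub>-\<^sub>1\<close> to \<open>\<zeta>\<^sub>i\<close>. The interval \<open>S\<^sub>i\<close> is the
  image of that one under the dilation by \<open>\<theta>\<^sub>i\<close> about \<open>v i\<close>, whence the factor \<open>\<theta>\<^sub>i ^ j\<close>, and the
  \<open>j\<close>-th derivatives of \<open>G\<close> and \<open>q\<close> at \<open>v i\<close> differ exactly by the quotient of binomial coefficients.
\<close>

section \<open>Taylor coefficients and identity of polynomials\<close>

lemma higher_pderiv_pcompose_shift: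
  fixes p :: "real poly"
  shows "(pderiv ^^ j) (pcompose p [:c, 1:]) = pcompose ((pderiv ^^ j) p) [:c, 1:]"
  by (induction j) (simp_all add: pderiv_pcompose pderiv_pCons)

text \<open>Translating by \<open>c\<close> moves the expansion point to 0. Later conditions on
  derivatives at a vertex thus become conditions on coefficients of the shifted polynomial.\<close>

lemma poly_higher_pderiv_eq_coeff:
  fixes p :: "real poly"
  shows "poly ((pderiv ^^ j) p) c = fact j * coeff (pcompose p [:c, 1:]) j"
proof -
  have "poly ((pderiv ^^ j) p) c = coeff ((pderiv ^^ j) (pcompose p [:c, 1:])) 0"
    by (simp add: higher_pderiv_pcompose_shift flip: poly_0_coeff_0) (simp add: poly_pcompose)
  then show ?thesis
    by (simp add: coeff_higher_pderiv pochhammer_fact)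
qed

lemma poly_eq_sum_atMost:
  fixes p :: "real poly"
  assumes "degree p \<le> d"
  shows "poly p x = (\<Sum>m\<le>d. coeff p m * x ^ m)"
  unfolding poly_altdef using assms
  by (intro sum.mono_neutral_left) (auto simp: coeff_eq_0)

lemma poly_eqI_infinite:
  fixes p q :: "real poly"
  assumes "infinite A" and "\<And>x. x \<in> A \<Longrightarrow> poly p x = poly q x"
  shows "p = q"
proof (rule ccontr)
  assume "p \<noteq> q"
  then have "finite {x. poly (p - q) x = 0}"
    by (intro poly_roots_finite) simp
  moreover have "A \<subseteq> {x. poly (p - q) x = 0}"
    using assms(2) by auto
  ultimately show False
    using assms(1) finite_subset by blast
qed

section \<open>Blossoms\<close>

text \<open>Pascal's rule, arranged as the induction step of the Bernstein expansion of a blossom: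
  one further argument is split into its \<open>s\<close> part and its \<open>t\<close>
  part.\<close>

lemma binomial_sum_Suc:
  fixes s t :: real
  shows "(\<Sum>j\<le>Suc m. real (Suc m choose j) * s ^ (Suc m - j) * t ^ j * c j) =
    s * (\<Sum>j\<le>m. real (m choose j) * s ^ (m - j) * t ^ j * c j) +
    t * (\<Sum>j\<le>m. real (m choose j) * s ^ (m - j) * t ^ j * c (Suc j))"
proof -
  have "s * (\<Sum>j\<le>m. real (m choose j) * s ^ (m - j) * t ^ j * c j) =
      (\<Sum>j\<le>Suc m. real (m choose j) * s ^ (Suc m - j) * t ^ j * c j)"
    by (simp add: sum_distrib_left Suc_diff_le mult_ac)
  also have "\<dots> = s ^ Suc m * c 0 +
      (\<Sum>j\<le>m. real (m choose Suc j) * s ^ (m - j) * t ^ Suc j * c (Suc j))"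
    by (subst sum.atMost_Suc_shift) simp
  finally show ?thesis
    by (subst sum.atMost_Suc_shift)
       (simp add: algebra_simps sum.distrib sum_distrib_left)
qed

text \<open>Affinity is restated with the varying entry between two lists, which suits inductions
  along a prefix better than list updates.\<close>

lemma is_blossomD:
  assumes "is_blossom d p F"
  shows "\<And>xs ys. length xs = d \<Longrightarrow> mset xs = mset ys \<Longrightarrow> F xs = F ys"
    and "\<And>xs ys x y t. length xs + Suc (length ys) = d \<Longrightarrow>
      F (xs @ ((1 - t) * x + t * y) # ys) = (1 - t) * F (xs @ x # ys) + t * F (xs @ y # ys)"
    and "\<And>x. F (replicate d x) = poly p x"
proof -
  show "F (xs @ ((1 - t) * x + t * y) # ys) = (1 - t) * F (xs @ x # ys) + t * F (xs @ y # ys)"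
    if "length xs + Suc (length ys) = d" for xs ys x y t
  proof -
    have "F ((xs @ x # ys)[length xs := (1 - t) * x + t * y]) =
      (1 - t) * F ((xs @ x # ys)[length xs := x]) + t * F ((xs @ x # ys)[length xs := y])"
      using assms that unfolding is_blossom_def by (metis add_diff_cancel_left' length_append
          length_Cons less_add_same_cancel1 zero_less_Suc)
    then show ?thesis by (simp only: list_update_length)
  qed
qed (use assms in \<open>unfold is_blossom_def, blast+\<close>)

text \<open>Affinity expands one entry of the block at a time, and symmetry moves each new
  \<open>y\<close> to the end. The prefix \<open>xs\<close> is arbitrary because it absorbs the
  entry just expanded.\<close>

lemma blossom_bernstein_expansion:
  assumes "is_blossom d p F" and "length xs + m = d"
  shows "F (xs @ replicate m ((1 - t) * x + t * y)) =
    (\<Sum>j\<le>m. real (m choose j) * (1 - t) ^ (m - j) * t ^ j *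
       F (xs @ replicate (m - j) x @ replicate j y))"
  using assms(2)
proof (induction m arbitrary: xs)
  case 0
  then show ?case by simp
next
  case (Suc m)
  let ?z = "(1 - t) * x + t * y"
  let ?c = "\<lambda>j. F (xs @ replicate (Suc m - j) x @ replicate j y)"
  have "F (xs @ replicate (Suc m) ?z) =
      (1 - t) * F ((xs @ [x]) @ replicate m ?z) + t * F ((xs @ [y]) @ replicate m ?z)"
    using is_blossomD(2)[OF assms(1), of xs "replicate m ?z" t x y] Suc.prems by simp
  moreover have "F ((xs @ [x]) @ replicate m ?z) =
      (\<Sum>j\<le>m. real (m choose j) * (1 - t) ^ (m - j) * t ^ j * ?c j)"
    using Suc.prems
    by (subst Suc.IH) (auto simp: Suc_diff_le intro!: sum.cong)
  moreover have "F ((xs @ [y]) @ replicate m ?z) =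
      (\<Sum>j\<le>m. real (m choose j) * (1 - t) ^ (m - j) * t ^ j * ?c (Suc j))"
    using Suc.prems
    by (subst Suc.IH) (auto intro!: sum.cong is_blossomD(1)[OF assms(1)])
  ultimately show ?case
    by (simp only: binomial_sum_Suc)
qed

text \<open>
  With \<open>t = u / (1 + u)\<close> the Bernstein expansion becomes, up to the factor \<open>(1 + u) ^ m\<close>, a
  polynomial in \<open>u\<close> whose coefficients are the blossom values up to binomial factors. If the
  left-hand side vanishes for all \<open>u > 0\<close>, so do the coefficients.
\<close>

lemma blossom_of_zero:
  assumes F: "is_blossom d 0 F" and "length xs \<le> d"
  shows "F (xs @ replicate (d - length xs) y) = 0"
  using assms(2)
proof (induction xs arbitrary: y rule: rev_induct)
  case Nil
  show ?case using is_blossomD(3)[OF F] by simp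
next
  case (snoc x xs)
  define m where "m = d - length xs"
  have m: "m \<ge> 1" "length xs + m = d"
    using snoc.prems by (auto simp: m_def)
  define c where "c j = F (xs @ replicate (m - j) x @ replicate j y)" for j
  define P where "P = (\<Sum>j\<le>m. monom (real (m choose j) * c j) j)"
  have "poly P u = poly 0 u" if "u \<in> {0<..}" for u
  proof -
    have u: "u > 0" using that by simp
    define t where "t = u / (1 + u)"
    have t: "1 - t = 1 / (1 + u)" using u by (simp add: t_def field_simps)
    \<comment> \<open>The induction hypothesis is applied with a point between \<open>x\<close> and
      \<open>y\<close> as the repeated argument.\<close>
    have "0 = F (xs @ replicate m ((1 - t) * x + t * y))"
      using snoc unfolding m_def by simp
    also have "\<dots> = (\<Sum>j\<le>m. real (m choose j) * (1 - t) ^ (m - j) * t ^ j * c j)"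
      unfolding c_def using F m(2) by (rule blossom_bernstein_expansion)
    also have "\<dots> = (\<Sum>j\<le>m. (real (m choose j) * c j * u ^ j) / (1 + u) ^ m)"
    proof (intro sum.cong refl)
      fix j assume "j \<in> {..m}"
      then have "(1 + u) ^ m = (1 + u) ^ (m - j) * (1 + u) ^ j"
        by (simp flip: power_add)
      then show "real (m choose j) * (1 - t) ^ (m - j) * t ^ j * c j =
          (real (m choose j) * c j * u ^ j) / (1 + u) ^ m"
        unfolding t by (simp add: t_def power_divide)
    qed
    also have "\<dots> = poly P u / (1 + u) ^ m"
      by (simp add: P_def poly_sum poly_monom sum_divide_distrib)
    finally show ?thesis using u by simp
  qed
  then have "P = 0"
    by (intro poly_eqI_infinite[of "{0<..}"]) (auto simp: infinite_Ioi)
  \<comment> \<open>This coefficient carries the value at one \<open>x\<close> and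
    \<open>m - 1\<close> copies of \<open>y\<close>, which is the value claimed to vanish.\<close>
  moreover have "coeff P (m - 1) = real (m choose (m - 1)) * c (m - 1)"
    by (simp add: P_def coeff_sum)
  moreover have "m choose (m - 1) \<noteq> 0"
    by simp
  ultimately have "c (m - 1) = 0"
    by (metis coeff_0 mult_eq_0_iff of_nat_eq_0_iff)
  then show ?case
    using m by (simp add: c_def m_def)
qed

text \<open>The difference of two blossoms of \<open>p\<close> is a blossom of 0 and hence vanishes
  on lists of length \<open>d\<close>; on all other lists both are \<open>undefined\<close>.\<close>

lemma is_blossom_unique:
  assumes F: "is_blossom d p F" and G: "is_blossom d p G"
  shows "F = G"
proof
  fix xs
  let ?H = "\<lambda>xs\<in>{xs. length xs = d}. F xs - G xs"
  have H: "is_blossom d 0 ?H"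
    unfolding is_blossom_def
  proof (intro conjI allI impI, goal_cases)
    case 1
    show ?case by auto
  next
    case (2 xs ys)
    then have "length ys = d" using mset_eq_length by fastforce
    with 2 is_blossomD(1)[OF F, of xs ys] is_blossomD(1)[OF G, of xs ys] show ?case by simp
  next
    case (3 xs k x y t)
    then have "F (xs[k := (1 - t) * x + t * y]) = (1 - t) * F (xs[k := x]) + t * F (xs[k := y])"
      and "G (xs[k := (1 - t) * x + t * y]) = (1 - t) * G (xs[k := x]) + t * G (xs[k := y])"
      using F G unfolding is_blossom_def by blast+
    with 3 show ?case by (simp add: algebra_simps)
  next
    case (4 x)
    show ?case using is_blossomD(3)[OF F] is_blossomD(3)[OF G] by simp
  qed
  show "F xs = G xs"
  proof (cases "length xs = d")
    case True
    then show ?thesis using blossom_of_zero[OF H, of xs] by simp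
  next
    case False
    then show ?thesis using F G by (auto simp: is_blossom_def PiE_iff extensional_def)
  qed
qed

text \<open>
  The \<open>m\<close>-th coefficient of \<open>\<Prod>(1 + (x - c) X)\<close> is the \<open>m\<close>-th elementary symmetric function of the
  differences \<open>x - c\<close>, the unnormalised blossom of \<open>(x - c) ^ m\<close>.
\<close>

definition centered_blossom :: "real \<Rightarrow> nat \<Rightarrow> real poly \<Rightarrow> real list \<Rightarrow> real" where
  "centered_blossom c d p xs =
    (\<Sum>m\<le>d. coeff (pcompose p [:c, 1:]) m / real (d choose m) *
       coeff (\<Prod>x\<leftarrow>xs. [:1, x - c:]) m)"

lemma is_blossom_centered_blossom:
  assumes "degree p \<le> d"
  shows "is_blossom d p (restrict (centered_blossom c d p) {xs. length xs = d})"
proof -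
  have sym: "centered_blossom c d p xs = centered_blossom c d p ys" if "mset xs = mset ys" for xs ys
  proof -
    have "mset (map (\<lambda>x. [:1, x - c:]) xs) = mset (map (\<lambda>x. [:1, x - c:]) ys)"
      using that by simp
    then have "prod_list (map (\<lambda>x. [:1, x - c:]) xs) = prod_list (map (\<lambda>x. [:1, x - c:]) ys)"
      by (metis prod_mset_prod_list)
    then show ?thesis by (simp add: centered_blossom_def)
  qed
  have aff: "centered_blossom c d p (xs[k := (1 - t) * x + t * y]) =
      (1 - t) * centered_blossom c d p (xs[k := x]) + t * centered_blossom c d p (xs[k := y])"
    if k: "k < length xs" for xs k t x y
  proof -
    let ?P = "\<lambda>z. \<Prod>x\<leftarrow>xs[k := z]. [:1, x - c:]"
    \<comment> \<open>\<open>R\<close> collects the factors of all entries but the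
      \<open>k\<close>-th, so the whole product is affine in that entry.\<close>
    define R where "R = (\<Prod>x\<leftarrow>take k xs. [:1, x - c:]) * (\<Prod>x\<leftarrow>drop (Suc k) xs. [:1, x - c:])"
    have P: "?P z = [:1, z - c:] * R" for z
      using k by (simp only: upd_conv_take_nth_drop R_def) (simp add: algebra_simps)
    have "[:1, (1 - t) * x + t * y - c:] = smult (1 - t) [:1, x - c:] + smult t [:1, y - c:]"
      by (simp add: algebra_simps)
    then have "?P ((1 - t) * x + t * y) = smult (1 - t) (?P x) + smult t (?P y)"
      unfolding P by (simp only: distrib_right mult_smult_left)
    then have "coeff (?P ((1 - t) * x + t * y)) m = (1 - t) * coeff (?P x) m + t * coeff (?P y) m"
      for m
      by (simp only: coeff_add coeff_smult)
    then show ?thesis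
      unfolding centered_blossom_def
      by (simp only: sum_distrib_left flip: sum.distrib) (simp only: algebra_simps)
  qed
  have diag: "centered_blossom c d p (replicate d x) = poly p x" for x
  proof -
    \<comment> \<open>On the diagonal the product is a power of one linear factor; its
      \<open>m\<close>-th coefficient contains \<open>d choose m\<close>, which cancels the
      divisor.\<close>
    have "centered_blossom c d p (replicate d x) =
        (\<Sum>m\<le>d. coeff (pcompose p [:c, 1:]) m * (x - c) ^ m)"
      unfolding centered_blossom_def
      by (intro sum.cong) (simp_all add: prod_list_replicate coeff_linear_poly_power)
    also have "\<dots> = poly (pcompose p [:c, 1:]) (x - c)"
      using assms by (intro poly_eq_sum_atMost[symmetric]) (simp add: degree_pcompose)
    finally show ?thesis by (simp add: poly_pcompose)
  qed
  show ?thesis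
    unfolding is_blossom_def
  proof (intro conjI allI impI, goal_cases)
    case (2 xs ys)
    then have "length ys = d" using mset_eq_length by fastforce
    with 2 sym[of xs ys] show ?case by simp
  qed (simp_all add: aff diag)
qed

lemma is_blossom_blossom:
  assumes "degree p \<le> d"
  shows "is_blossom d p (blossom d p)"
  unfolding blossom_def
proof (rule theI'[of "is_blossom d p"])
  show "\<exists>!F. is_blossom d p F"
    using is_blossom_centered_blossom[OF assms, of 0] is_blossom_unique by blast
qed

text \<open>By uniqueness the formula does not depend on its centre, so \<open>c\<close> can be
  chosen to suit the arguments.\<close>

lemma blossom_eq_centered_blossom:
  assumes "degree p \<le> d" and "length xs = d"
  shows "blossom d p xs = centered_blossom c d p xs"
  using is_blossom_unique[OF is_blossom_blossom is_blossom_centered_blossom[where c = c],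
      OF assms(1,1)] assms(2)
  by simp

section \<open>Reproduction of Taylor data at a vertex\<close>

lemma sum_multi_indices:
  "(\<Sum>\<alpha>\<in>multi_indices m. f \<alpha>) = (\<Sum>j\<le>m. f (m - j, j))"
  by (rule sum.reindex_bij_witness[of _ "\<lambda>j. (m - j, j)" snd]) (auto simp: multi_indices_def)

lemma finite_multi_indices [simp]: "finite (multi_indices m)"
  by (rule finite_subset[of _ "{..m} \<times> {..m}"]) (auto simp: multi_indices_def)

text \<open>Centring at \<open>v\<close> turns the factor of the argument \<open>v\<close> into 1.
  The remaining product has degree at most \<open>m\<close>, so the term of order
  \<open>Suc m\<close> drops out.\<close>

lemma blossom_vertex_diagonal:
  assumes "degree q \<le> Suc m"
  shows "blossom (Suc m) q (v # replicate m u) =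
    (\<Sum>k\<le>m. coeff (pcompose q [:v, 1:]) k * (real (m choose k) / real (Suc m choose k)) * (u - v) ^ k)"
proof -
  have "blossom (Suc m) q (v # replicate m u) =
      (\<Sum>k\<le>Suc m. coeff (pcompose q [:v, 1:]) k / real (Suc m choose k) * coeff ([:1, u - v:] ^ m) k)"
    using assms
    by (simp only: blossom_eq_centered_blossom[where c = v] length_Cons length_replicate)
       (simp add: centered_blossom_def prod_list_replicate flip: one_pCons)
  also have "\<dots> = (\<Sum>k\<le>m. coeff (pcompose q [:v, 1:]) k / real (Suc m choose k) *
      coeff ([:1, u - v:] ^ m) k)"
    by (simp add: coeff_eq_0 degree_power_eq le_less_trans[OF degree_power_le])
  also have "\<dots> = (\<Sum>k\<le>m. coeff (pcompose q [:v, 1:]) k *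
      (real (m choose k) / real (Suc m choose k)) * (u - v) ^ k)"
    by (intro sum.cong) (simp_all add: coeff_linear_poly_power)
  finally show ?thesis .
qed

lemma poly_bernstein_poly:
  "poly (bernstein_poly \<alpha> A B) y = fact (fst \<alpha> + snd \<alpha>) / (fact (fst \<alpha>) * fact (snd \<alpha>)) *
    ((B - y) ^ fst \<alpha> * (y - A) ^ snd \<alpha>) / (B - A) ^ (fst \<alpha> + snd \<alpha>)"
  by (simp add: bernstein_poly_def Let_def)

lemma poly_bernstein_poly_barycentric:
  assumes "j \<le> m" and "l \<noteq> r"
  shows "poly (bernstein_poly (m - j, j) l r) ((1 - t) * l + t * r) =
    real (m choose j) * (1 - t) ^ (m - j) * t ^ j"
proof -
  have diffs: "r - ((1 - t) * l + t * r) = (1 - t) * (r - l)" "((1 - t) * l + t * r) - l = t * (r - l)"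
    by (simp_all add: algebra_simps)
  have "(r - l) ^ m = (r - l) ^ (m - j) * (r - l) ^ j"
    using assms(1) by (simp flip: power_add)
  then show ?thesis
    using assms unfolding poly_bernstein_poly diffs power_mult_distrib
    by (simp add: binomial_fact mult_ac)
qed

text \<open>At every \<open>u\<close> both sides equal the blossom at \<open>v\<close> and
  \<open>m\<close> copies of \<open>u\<close>: the left one by the Bernstein expansion over
  \<open>l\<close> and \<open>r\<close>, the right one by the Taylor expansion at
  \<open>v\<close>.\<close>

lemma blossom_bernstein_sum:
  assumes "degree q \<le> Suc m" and "l \<noteq> r"
  shows "(\<Sum>\<alpha>\<in>multi_indices m.
      smult (blossom (Suc m) q (v # replicate (fst \<alpha>) l @ replicate (snd \<alpha>) r)) (bernstein_poly \<alpha> l r)) =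
    pcompose (\<Sum>k\<le>m. monom (coeff (pcompose q [:v, 1:]) k * (real (m choose k) / real (Suc m choose k))) k)
      [:-v, 1:]" (is "?L = ?R")
proof (rule poly_eqI_infinite[OF infinite_UNIV_char_0])
  fix u :: real
  define t where "t = (u - l) / (r - l)"
  have u: "u = (1 - t) * l + t * r"
    using assms(2) by (simp add: t_def divide_simps) (simp add: algebra_simps)
  have "poly ?L u = (\<Sum>j\<le>m. real (m choose j) * (1 - t) ^ (m - j) * t ^ j *
      blossom (Suc m) q ([v] @ replicate (m - j) l @ replicate j r))"
    unfolding sum_multi_indices poly_sum u using assms(2)
    by (intro sum.cong) (simp_all add: poly_bernstein_poly_barycentric del: distrib_left_numeral)
  also have "\<dots> = blossom (Suc m) q ([v] @ replicate m ((1 - t) * l + t * r))"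
    by (rule blossom_bernstein_expansion[OF is_blossom_blossom[OF assms(1)], symmetric]) simp
  also have "\<dots> = poly ?R u"
    using assms(1)
    by (simp add: blossom_vertex_diagonal u[symmetric] poly_pcompose poly_sum poly_monom)
  finally show "poly ?L u = poly ?R u" .
qed

text \<open>Bernstein polynomials are invariant under affine maps that move interval and argument
  together; here the map is the dilation by \<open>\<theta>\<close> about \<open>v\<close>, in
  coordinates with origin \<open>v\<close>.\<close>

lemma bernstein_poly_dilate:
  assumes "\<theta> \<noteq> 0"
  shows "pcompose (bernstein_poly \<alpha> (\<theta> * l + (1 - \<theta>) * v) (\<theta> * r + (1 - \<theta>) * v)) [:v, \<theta>:] =
    pcompose (bernstein_poly \<alpha> l r) [:v, 1:]"
proof (rule poly_eqI_infinite[OF infinite_UNIV_char_0])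
  fix x :: real
  have diffs: "\<theta> * r + (1 - \<theta>) * v - (v + x * \<theta>) = \<theta> * (r - (v + x))"
    "(v + x * \<theta>) - (\<theta> * l + (1 - \<theta>) * v) = \<theta> * (v + x - l)"
    "\<theta> * r + (1 - \<theta>) * v - (\<theta> * l + (1 - \<theta>) * v) = \<theta> * (r - l)"
    by (simp_all add: algebra_simps)
  have "poly [:v, \<theta>:] x = v + x * \<theta>" and "poly [:v, 1:] x = v + x"
    by simp_all
  then show "poly (pcompose (bernstein_poly \<alpha> (\<theta> * l + (1 - \<theta>) * v) (\<theta> * r + (1 - \<theta>) * v)) [:v, \<theta>:]) x =
      poly (pcompose (bernstein_poly \<alpha> l r) [:v, 1:]) x"
    using assms by (simp only: poly_pcompose poly_bernstein_poly power_add diffs power_mult_distrib) simp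
qed

lemma higher_pderiv_bernstein_poly_dilate:
  assumes "\<theta> \<noteq> 0"
  shows "\<theta> ^ j * poly ((pderiv ^^ j)
      (bernstein_poly \<alpha> (\<theta> * l + (1 - \<theta>) * v) (\<theta> * r + (1 - \<theta>) * v))) v =
    poly ((pderiv ^^ j) (bernstein_poly \<alpha> l r)) v"
proof -
  have "pcompose p [:v, \<theta>:] = pcompose (pcompose p [:v, 1:]) [:0, \<theta>:]" for p
    by (simp add: pcompose_pCons flip: pcompose_assoc)
  then have "\<theta> ^ j * coeff (pcompose p [:v, 1:]) j = coeff (pcompose p [:v, \<theta>:]) j" for p
    by (simp add: coeff_pcompose_linear)
  then show ?thesis
    using assms by (simp add: poly_higher_pderiv_eq_coeff mult.left_commute bernstein_poly_dilate)
qed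

text \<open>Passing from \<open>q\<close> to its partially fixed blossom multiplies the
  \<open>j\<close>-th Taylor coefficient at \<open>v\<close> by
  \<open>(m choose j) / (Suc m choose j)\<close>. The weights contain the reciprocal, and
  \<open>\<theta> ^ j\<close> undoes the dilation.\<close>

lemma vertex_reproduction:
  assumes "degree q \<le> Suc m" and "l \<noteq> r" and "\<theta> \<noteq> 0" and "j \<le> m"
  shows "(\<Sum>\<alpha>\<in>multi_indices m.
      blossom (Suc m) q (v # replicate (fst \<alpha>) l @ replicate (snd \<alpha>) r) *
      (real (Suc m choose j) / real (m choose j) * \<theta> ^ j * poly ((pderiv ^^ j)
        (bernstein_poly \<alpha> (\<theta> * l + (1 - \<theta>) * v) (\<theta> * r + (1 - \<theta>) * v))) v)) =
    poly ((pderiv ^^ j) q) v" (is "?L = _")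
proof -
  let ?b = "\<lambda>\<alpha>. blossom (Suc m) q (v # replicate (fst \<alpha>) l @ replicate (snd \<alpha>) r)"
  let ?G = "\<Sum>\<alpha>\<in>multi_indices m. smult (?b \<alpha>) (bernstein_poly \<alpha> l r)"
  have "?L = real (Suc m choose j) / real (m choose j) * poly ((pderiv ^^ j) ?G) v"
    using assms(3)
    unfolding higher_pderiv_sum higher_pderiv_smult poly_sum sum_distrib_left poly_smult
    by (intro sum.cong)
       (simp_all add: mult.left_commute flip: higher_pderiv_bernstein_poly_dilate[of \<theta> j _ l v r])
  also have "pcompose ?G [:v, 1:] = (\<Sum>k\<le>m. monom (coeff (pcompose q [:v, 1:]) k *
      (real (m choose k) / real (Suc m choose k))) k)"
    unfolding blossom_bernstein_sum[OF assms(1,2)] by (simp add: pcompose_pCons flip: pcompose_assoc)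
  then have "poly ((pderiv ^^ j) ?G) v =
      fact j * (coeff (pcompose q [:v, 1:]) j * (real (m choose j) / real (Suc m choose j)))"
    using assms(4) by (simp add: poly_higher_pderiv_eq_coeff coeff_sum)
  finally show ?thesis
    using assms(4) by (simp add: poly_higher_pderiv_eq_coeff)
qed

section \<open>Splines on a split partition\<close>

lemma piece_eqI:
  assumes "A < B" and "\<And>x. x \<in> {A<..<B} \<Longrightarrow> s x = poly q x"
  shows "piece s A B = q"
  unfolding piece_def
proof (rule the_equality)
  show "p = q" if "\<forall>x\<in>{A<..<B}. s x = poly p x" for p
    using assms that by (intro poly_eqI_infinite[of "{A<..<B}"]) (auto simp: infinite_Ioo)
qed (use assms in blast)

lemma agree_at_1_iff:
  "agree_at 1 p q x \<longleftrightarrow> poly p x = poly q x \<and> poly (pderiv p) x = poly (pderiv q) x"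
  by (auto simp: agree_at_def le_Suc_eq)

lemma poly_pderiv_linear_power:
  fixes v :: real
  shows "poly (pderiv ([:-v, 1:] ^ d)) z = real d * (z - v) ^ (d - 1)"
  by (cases d) (simp_all add: pderiv_power_Suc pderiv_pCons del: power_Suc)

text \<open>
  Both lemmas solve the same \<open>2 \<times> 2\<close> system in \<open>X = a (z - v) ^ (d - 1)\<close> and
  \<open>Y = b (z - w) ^ (e - 1)\<close>, whose determinant \<open>d (z - w) - e (z - v)\<close> is negative.
\<close>

lemma agree_at_1_add_powers_unique:
  assumes "v < z" "z < w" "d \<ge> 1" "e \<ge> 1" "agree_at 1 p q z"
    and "agree_at 1 (p + smult a ([:-v, 1:] ^ d)) (q + smult b ([:-w, 1:] ^ e)) z"
  shows "a = 0 \<and> b = 0"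
proof -
  define X where "X = a * (z - v) ^ (d - 1)"
  define Y where "Y = b * (z - w) ^ (e - 1)"
  have "a * (z - v) ^ d = b * (z - w) ^ e"
    and "a * (real d * (z - v) ^ (d - 1)) = b * (real e * (z - w) ^ (e - 1))"
    using assms(5,6) unfolding agree_at_1_iff pderiv_add pderiv_smult poly_add poly_smult
      poly_pderiv_linear_power by simp_all
  then have 1: "(z - v) * X = (z - w) * Y" and 2: "d * X = e * Y"
    using assms(3,4) by (auto simp: X_def Y_def mult_ac power_eq_if)
  have neg: "d * (z - w) < 0" "e * (z - v) > 0"
    using assms(1-4) by (simp_all add: mult_pos_neg)
  \<comment> \<open>Eliminating \<open>Y\<close> from the two equations leaves the determinant times
    \<open>X\<close>.\<close>
  have "(d * (z - w) - e * (z - v)) * X = (z - w) * (d * X) - e * ((z - v) * X)"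
    by (simp add: algebra_simps)
  also have "\<dots> = 0" unfolding 1 2 by simp
  finally have "X = 0" using neg by simp
  moreover from this have "Y = 0" using 2 assms(4) by simp
  ultimately show ?thesis
    using assms(1,2) by (simp add: X_def Y_def)
qed

lemma agree_at_1_add_powers_exists:
  assumes "v < z" "z < w" "d \<ge> 1" "e \<ge> 1"
  shows "\<exists>a b. agree_at 1 (p + smult a ([:-v, 1:] ^ d)) (q + smult b ([:-w, 1:] ^ e)) z"
proof -
  define A where "A = poly q z - poly p z"
  define B where "B = poly (pderiv q) z - poly (pderiv p) z"
  define D where "D = d * (z - w) - e * (z - v)"
  \<comment> \<open>Cramer's rule for \<open>(z - v) * X - (z - w) * Y = A\<close> and
    \<open>d * X - e * Y = B\<close>.\<close>
  define X where "X = ((z - w) * B - e * A) / D"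
  define Y where "Y = ((z - v) * B - d * A) / D"
  have "d * (z - w) < 0" "e * (z - v) > 0"
    using assms by (simp_all add: mult_pos_neg)
  then have D: "D \<noteq> 0" by (simp add: D_def)
  have X: "D * X = (z - w) * B - e * A" and Y: "D * Y = (z - v) * B - d * A"
    using D by (simp_all add: X_def Y_def)
  have "D * ((z - v) * X - (z - w) * Y) = (z - v) * (D * X) - (z - w) * (D * Y)"
    and "D * (d * X - e * Y) = d * (D * X) - e * (D * Y)"
    by (simp_all only: right_diff_distrib mult.left_commute)
  then have "D * ((z - v) * X - (z - w) * Y) = D * A" and "D * (d * X - e * Y) = D * B"
    unfolding X Y by (simp_all add: D_def algebra_simps)
  then have 1: "(z - v) * X - (z - w) * Y = A" and 2: "d * X - e * Y = B"
    using D by simp_all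
  define a where "a = X / (z - v) ^ (d - 1)"
  define b where "b = Y / (z - w) ^ (e - 1)"
  have "a * (z - v) ^ (d - 1) = X" "b * (z - w) ^ (e - 1) = Y"
    using assms by (simp_all add: a_def b_def)
  moreover from this have "a * (z - v) ^ d = (z - v) * X" "b * (z - w) ^ e = (z - w) * Y"
    using assms(3,4) by (auto simp: power_eq_if mult_ac)
  ultimately have "agree_at 1 (p + smult a ([:-v, 1:] ^ d)) (q + smult b ([:-w, 1:] ^ e)) z"
    using 1 2 unfolding agree_at_1_iff pderiv_add pderiv_smult poly_add poly_smult
      poly_pderiv_linear_power mult.left_commute[of a] mult.left_commute[of b]
    by (simp add: A_def B_def)
  then show ?thesis by blast
qed

section \<open>Polynomials with prescribed derivatives at a vertex\<close>

lemma pcompose_shift_inverse: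
  fixes p :: "real poly"
  shows "pcompose (pcompose p [:-c, 1:]) [:c, 1:] = p" "pcompose (pcompose p [:c, 1:]) [:-c, 1:] = p"
  by (simp_all add: pcompose_pCons flip: pcompose_assoc)

lemma pcompose_monom_shift:
  "pcompose (monom a d) [:-c, 1:] = smult a ([:-c, 1:] ^ d)" for a c :: real
  by (induction d) (simp_all add: monom_0 monom_Suc pcompose_pCons)

text \<open>After moving \<open>v\<close> to 0, equal data remove the coefficients of the difference
  below \<open>d\<close> and the degree bound removes those above, leaving one monomial.\<close>

lemma hermite_data_eq_imp:
  fixes p q :: "real poly"
  assumes "degree p \<le> d" "degree q \<le> d"
    and "\<And>j. j < d \<Longrightarrow> poly ((pderiv ^^ j) p) v = poly ((pderiv ^^ j) q) v"
  obtains a where "p = q + smult a ([:-v, 1:] ^ d)"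
proof -
  let ?r = "pcompose (p - q) [:v, 1:]"
  have "coeff ?r j = 0" if "j \<noteq> d" for j
  proof (cases "j < d")
    case True
    then show ?thesis
      using assms(3)[of j] by (simp add: poly_higher_pderiv_eq_coeff pcompose_diff)
  next
    case False
    have "degree ?r \<le> d" using assms(1,2) by (simp add: degree_pcompose degree_diff_le)
    with False that show ?thesis by (intro coeff_eq_0) simp
  qed
  then have "?r = monom (coeff ?r d) d"
    by (intro poly_eqI) simp
  then have "p - q = smult (coeff ?r d) ([:-v, 1:] ^ d)"
    by (metis pcompose_monom_shift pcompose_shift_inverse(2))
  then show ?thesis
    using that by (metis add.commute diff_add_cancel)
qed

text \<open>\<open>T\<close> is the Taylor polynomial with the given data. Multiples of
  \<open>(x - v) ^ d\<close> do not affect derivatives of order below \<open>d\<close>, so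
  \<open>a\<close> stays free for the conditions at a split point.\<close>

lemma hermite_data_exists:
  obtains T :: "real poly" where "\<And>a. degree (T + smult a ([:-v, 1:] ^ d)) \<le> d"
    and "\<And>a j. j < d \<Longrightarrow> poly ((pderiv ^^ j) (T + smult a ([:-v, 1:] ^ d))) v = c j"
proof -
  define S where "S = (\<Sum>j<d. monom (c j / fact j) j)"
  define T where "T = pcompose S [:-v, 1:]"
  have deg: "degree (S + monom a d) \<le> d" for a
    unfolding S_def by (intro degree_add_le degree_sum_le)
      (auto intro: order_trans[OF degree_monom_le])
  have T: "T + smult a ([:-v, 1:] ^ d) = pcompose (S + monom a d) [:-v, 1:]" for a
    by (simp add: T_def pcompose_add pcompose_monom_shift)
  show ?thesis
  proof
    show "degree (T + smult a ([:-v, 1:] ^ d)) \<le> d" for a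
      unfolding T using deg by (simp add: degree_pcompose)
    show "poly ((pderiv ^^ j) (T + smult a ([:-v, 1:] ^ d))) v = c j" if "j < d" for a j
      unfolding T poly_higher_pderiv_eq_coeff pcompose_shift_inverse
      using that by (simp add: S_def coeff_sum)
  qed
qed

section \<open>Splines described by their polynomial pieces\<close>

locale split_partition =
  fixes n :: nat and v \<zeta> :: "nat \<Rightarrow> real" and \<phi> :: "nat \<Rightarrow> nat"
  assumes n_pos: "n \<ge> 1"
    and v_step: "i < n \<Longrightarrow> v i < v (Suc i)"
    and \<zeta>_between: "i < n \<Longrightarrow> \<zeta> i \<in> {v i<..<v (Suc i)}"
    and \<phi>_ge: "i \<le> n \<Longrightarrow> \<phi> i \<ge> 2"
begin

lemma v_mono: "i \<le> j \<Longrightarrow> j \<le> n \<Longrightarrow> v i \<le> v j"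
proof (induction j rule: dec_induct)
  case (step j)
  then show ?case using v_step[of j] by simp
qed simp

lemma cell_subset: "i < n \<Longrightarrow> {v i..v (Suc i)} \<subseteq> {v 0..v n}"
  using v_mono[of 0 i] v_mono[of "Suc i" n] by auto

lemma zeta_left_less_zeta_right: "i \<le> n \<Longrightarrow> zeta_left v \<zeta> i < zeta_right n v \<zeta> i"
  using n_pos \<zeta>_between[of i] \<zeta>_between[of "i - 1"]
  by (cases i) (auto simp: zeta_left_def zeta_right_def)

text \<open>Explicit families avoid the description operator in \<open>piece\<close> and the
  degenerate intervals at both ends. \<open>L i\<close> is the piece ending at \<open>v i\<close>
  and \<open>R i\<close> the one starting there; \<open>L 0\<close> and \<open>R n\<close> belong to
  no interval and are left free.\<close>

definition has_pieces :: "(real \<Rightarrow> real) \<Rightarrow> (nat \<Rightarrow> real poly) \<Rightarrow> (nat \<Rightarrow> real poly) \<Rightarrow> bool" where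
  "has_pieces s L R \<longleftrightarrow> s \<in> {v 0..v n} \<rightarrow>\<^sub>E UNIV \<and>
    (\<forall>i<n. degree (R i) \<le> \<phi> i \<and> degree (L (Suc i)) \<le> \<phi> (Suc i) \<and>
       (\<forall>x\<in>{v i..\<zeta> i}. s x = poly (R i) x) \<and>
       (\<forall>x\<in>{\<zeta> i..v (Suc i)}. s x = poly (L (Suc i)) x) \<and>
       agree_at 1 (R i) (L (Suc i)) (\<zeta> i)) \<and>
    (\<forall>i. 0 < i \<and> i < n \<longrightarrow> agree_at (\<phi> i - 1) (L i) (R i) (v i))"

lemma piece_right:
  assumes "has_pieces s L R" "i < n"
  shows "piece s (v i) (\<zeta> i) = R i"
  using assms \<zeta>_between[of i] by (intro piece_eqI) (auto simp: has_pieces_def)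

lemma piece_left:
  assumes "has_pieces s L R" "i < n"
  shows "piece s (\<zeta> i) (v (Suc i)) = L (Suc i)"
  using assms \<zeta>_between[of i] by (intro piece_eqI) (auto simp: has_pieces_def)

lemma vertex_piece_eq:
  assumes "has_pieces s L R" "i \<le> n"
  shows "vertex_piece n v \<zeta> s i = (if i < n then R i else L n)"
  using assms piece_right[OF assms(1)] piece_left[OF assms(1), of "n - 1"] n_pos
  by (simp add: vertex_piece_def)

lemma spline_space_if_has_pieces:
  assumes s: "has_pieces s L R"
  shows "s \<in> spline_space n v \<zeta> \<phi>"
proof -
  have "\<exists>q\<in>polys_upto (\<phi> i). \<forall>x\<in>{zeta_left v \<zeta> i..v i}. s x = poly q x"
    if "i \<le> n" "zeta_left v \<zeta> i < v i" for i
  proof (cases i)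
    case 0
    then show ?thesis using that by (simp add: zeta_left_def)
  next
    case (Suc k)
    then show ?thesis using s that
      by (intro bexI[of _ "L i"]) (auto simp: has_pieces_def zeta_left_def polys_upto_def)
  qed
  moreover have "\<exists>q\<in>polys_upto (\<phi> i). \<forall>x\<in>{v i..zeta_right n v \<zeta> i}. s x = poly q x"
    if "i \<le> n" "v i < zeta_right n v \<zeta> i" for i
  proof (cases "i = n")
    case True
    then show ?thesis using that by (simp add: zeta_right_def)
  next
    case False
    then show ?thesis using s that
      by (intro bexI[of _ "R i"]) (auto simp: has_pieces_def zeta_right_def polys_upto_def)
  qed
  moreover have "agree_at (\<phi> i - 1) (piece s (\<zeta> (i - 1)) (v i)) (piece s (v i) (\<zeta> i)) (v i)"
    if "0 < i" "i < n" for i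
    using s that piece_left[OF s, of "i - 1"] piece_right[OF s, of i] by (simp add: has_pieces_def)
  moreover have "agree_at 1 (piece s (v i) (\<zeta> i)) (piece s (\<zeta> i) (v (Suc i))) (\<zeta> i)" if "i < n" for i
    using s that piece_left[OF s, of i] piece_right[OF s, of i] by (simp add: has_pieces_def)
  moreover have "s \<in> {v 0..v n} \<rightarrow>\<^sub>E UNIV"
    using s by (simp add: has_pieces_def)
  ultimately show ?thesis
    unfolding spline_space_def by blast
qed

lemma spline_space_has_pieces:
  assumes s: "s \<in> spline_space n v \<zeta> \<phi>"
  shows "has_pieces s (\<lambda>i. piece s (\<zeta> (i - 1)) (v i)) (\<lambda>i. piece s (v i) (\<zeta> i))"
proof -
  have R: "degree (piece s (v i) (\<zeta> i)) \<le> \<phi> i \<and> (\<forall>x\<in>{v i..\<zeta> i}. s x = poly (piece s (v i) (\<zeta> i)) x)"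
    if i: "i < n" for i
  proof -
    have "v i < zeta_right n v \<zeta> i" "zeta_right n v \<zeta> i = \<zeta> i" "i \<le> n"
      using i \<zeta>_between[of i] by (simp_all add: zeta_right_def)
    then have "\<exists>q\<in>polys_upto (\<phi> i). \<forall>x\<in>{v i..\<zeta> i}. s x = poly q x"
      using s unfolding spline_space_def mem_Collect_eq by metis
    then obtain q where q: "degree q \<le> \<phi> i" "\<forall>x\<in>{v i..\<zeta> i}. s x = poly q x"
      by (auto simp: polys_upto_def)
    moreover have "piece s (v i) (\<zeta> i) = q"
      using q i \<zeta>_between[of i] by (intro piece_eqI) auto
    ultimately show ?thesis by simp
  qed
  have L: "degree (piece s (\<zeta> i) (v (Suc i))) \<le> \<phi> (Suc i) \<and>
      (\<forall>x\<in>{\<zeta> i..v (Suc i)}. s x = poly (piece s (\<zeta> i) (v (Suc i))) x)" if i: "i < n" for i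
  proof -
    have "zeta_left v \<zeta> (Suc i) < v (Suc i)" "zeta_left v \<zeta> (Suc i) = \<zeta> i" "Suc i \<le> n"
      using i \<zeta>_between[of i] by (simp_all add: zeta_left_def)
    then have "\<exists>q\<in>polys_upto (\<phi> (Suc i)). \<forall>x\<in>{\<zeta> i..v (Suc i)}. s x = poly q x"
      using s unfolding spline_space_def mem_Collect_eq by metis
    then obtain q where q: "degree q \<le> \<phi> (Suc i)" "\<forall>x\<in>{\<zeta> i..v (Suc i)}. s x = poly q x"
      by (auto simp: polys_upto_def)
    moreover have "piece s (\<zeta> i) (v (Suc i)) = q"
      using q i \<zeta>_between[of i] by (intro piece_eqI) auto
    ultimately show ?thesis by simp
  qed
  show ?thesis
    unfolding has_pieces_def using s L R by (auto simp: spline_space_def)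
qed

lemma spline_space_iff: "s \<in> spline_space n v \<zeta> \<phi> \<longleftrightarrow> (\<exists>L R. has_pieces s L R)"
  using spline_space_if_has_pieces spline_space_has_pieces by blast

lemma has_pieces_poly:
  assumes "\<And>i. i \<le> n \<Longrightarrow> degree q \<le> \<phi> i"
  shows "has_pieces (\<lambda>x\<in>{v 0..v n}. poly q x) (\<lambda>_. q) (\<lambda>_. q)"
  unfolding has_pieces_def
proof (intro conjI allI impI ballI, goal_cases)
  case (4 i x)
  then have "x \<in> {v i..v (Suc i)}" using \<zeta>_between[of i] by auto
  then show ?case using cell_subset[OF 4(1)] by auto
next
  case (5 i x)
  then have "x \<in> {v i..v (Suc i)}" using \<zeta>_between[of i] by auto
  then show ?case using cell_subset[OF 5(1)] by auto
qed (use assms in \<open>auto simp: agree_at_def\<close>)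

lemma has_pieces_sum:
  assumes "finite A" and pc: "\<And>a. a \<in> A \<Longrightarrow> has_pieces (s a) (L a) (R a)"
  shows "has_pieces (\<lambda>x\<in>{v 0..v n}. \<Sum>a\<in>A. c a * s a x)
    (\<lambda>i. \<Sum>a\<in>A. smult (c a) (L a i)) (\<lambda>i. \<Sum>a\<in>A. smult (c a) (R a i))"
  unfolding has_pieces_def
proof (intro conjI allI impI ballI, goal_cases)
  case (2 i)
  then show ?case using pc assms(1)
    by (intro degree_sum_le) (auto simp: has_pieces_def intro: order_trans[OF degree_smult_le])
next
  case (3 i)
  then show ?case using pc assms(1)
    by (intro degree_sum_le) (auto simp: has_pieces_def intro: order_trans[OF degree_smult_le])
next
  case (4 i x)
  then have "x \<in> {v i..v (Suc i)}" using \<zeta>_between[of i] by auto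
  then have "x \<in> {v 0..v n}" using cell_subset[OF 4(1)] by blast
  then show ?case using 4 pc by (simp add: poly_sum has_pieces_def)
next
  case (5 i x)
  then have "x \<in> {v i..v (Suc i)}" using \<zeta>_between[of i] by auto
  then have "x \<in> {v 0..v n}" using cell_subset[OF 5(1)] by blast
  then show ?case using 5 pc by (simp add: poly_sum has_pieces_def)
next
  case (6 i)
  then show ?case using pc
    by (auto simp: agree_at_def has_pieces_def higher_pderiv_sum higher_pderiv_smult poly_sum
        intro!: sum.cong)
next
  case (7 i)
  then show ?case using pc
    by (auto simp: agree_at_def has_pieces_def higher_pderiv_sum higher_pderiv_smult poly_sum
        intro!: sum.cong)
qed simp

lemma spline_space_sum:
  assumes "finite A" and "\<And>a. a \<in> A \<Longrightarrow> s a \<in> spline_space n v \<zeta> \<phi>"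
  shows "(\<lambda>x\<in>{v 0..v n}. \<Sum>a\<in>A. c a * s a x) \<in> spline_space n v \<zeta> \<phi>"
  using has_pieces_sum[OF assms(1) spline_space_has_pieces[OF assms(2)]]
  by (rule spline_space_if_has_pieces)

lemma vertex_deriv_sum:
  assumes "finite A" and s: "\<And>a. a \<in> A \<Longrightarrow> s a \<in> spline_space n v \<zeta> \<phi>" and "i \<le> n"
  shows "vertex_deriv n v \<zeta> (\<lambda>x\<in>{v 0..v n}. \<Sum>a\<in>A. c a * s a x) j i =
    (\<Sum>a\<in>A. c a * vertex_deriv n v \<zeta> (s a) j i)"
proof -
  have "vertex_piece n v \<zeta> (\<lambda>x\<in>{v 0..v n}. \<Sum>a\<in>A. c a * s a x) i =
      (\<Sum>a\<in>A. smult (c a) (vertex_piece n v \<zeta> (s a) i))"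
    using vertex_piece_eq[OF has_pieces_sum[OF assms(1) spline_space_has_pieces[OF s]] assms(3)]
      vertex_piece_eq[OF spline_space_has_pieces[OF s] assms(3)]
    by (auto intro!: sum.cong)
  then show ?thesis
    by (simp add: vertex_deriv_def higher_pderiv_sum higher_pderiv_smult poly_sum)
qed

text \<open>The least index assigns a vertex to the cell on its left; only \<open>v 0\<close> goes
  to the cell on its right.\<close>

lemma cell_Least:
  assumes "i < n" and "v i < x \<or> i = 0" and "x \<le> v (Suc i)"
  shows "(LEAST k. x \<le> v (Suc k)) = i"
  using assms(3)
proof (rule Least_equality)
  show "i \<le> k" if "x \<le> v (Suc k)" for k
    using assms(1,2) that v_mono[of "Suc k" i] by (cases "i \<le> k") auto
qed

lemma obtain_cell:
  assumes "x \<in> {v 0..v n}"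
  obtains i where "i < n" "x \<in> {v i..v (Suc i)}"
proof -
  define i where "i = (LEAST k. x \<le> v (Suc k))"
  have n: "x \<le> v (Suc (n - 1))" using assms n_pos by simp
  have "x \<le> v (Suc i)" unfolding i_def using n by (rule LeastI)
  moreover have "i < n" using Least_le[of "\<lambda>k. x \<le> v (Suc k)", OF n] n_pos by (simp add: i_def)
  moreover have "v i \<le> x"
  proof (cases i)
    case (Suc k)
    then show ?thesis using not_less_Least[of k "\<lambda>k. x \<le> v (Suc k)"] by (simp add: i_def)
  qed (use assms in simp)
  ultimately show ?thesis using that by simp
qed

section \<open>Hermite interpolation by splines\<close>

lemma has_pieces_exists:
  assumes deg: "\<And>i. i \<le> n \<Longrightarrow> degree (L i) \<le> \<phi> i \<and> degree (R i) \<le> \<phi> i"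
    and ag: "\<And>i. i \<le> n \<Longrightarrow> agree_at (\<phi> i - 1) (L i) (R i) (v i)"
    and ag1: "\<And>i. i < n \<Longrightarrow> agree_at 1 (R i) (L (Suc i)) (\<zeta> i)"
  shows "\<exists>s. has_pieces s L R"
proof -
  \<comment> \<open>A split point takes its value from \<open>R i\<close>, and a vertex other than
    \<open>v 0\<close> from the piece on its left. Agreement of values then extends the formulas to
    closed intervals.\<close>
  define s where "s = (\<lambda>x\<in>{v 0..v n}. let i = LEAST k. x \<le> v (Suc k) in
    poly (if x \<le> \<zeta> i then R i else L (Suc i)) x)"
  have s: "s x = poly (if x \<le> \<zeta> i then R i else L (Suc i)) x"
    if "i < n" "v i < x \<or> i = 0 \<and> v 0 \<le> x" "x \<le> v (Suc i)" for i x
  proof -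
    have "x \<in> {v 0..v n}" using that cell_subset[of i] by auto
    moreover have "(LEAST k. x \<le> v (Suc k)) = i" using that by (intro cell_Least) auto
    ultimately show ?thesis by (simp add: s_def)
  qed
  have "s x = poly (R i) x" if i: "i < n" and x: "x \<in> {v i..\<zeta> i}" for i x
  proof (cases "v i < x \<or> i = 0")
    case True
    then show ?thesis using i x s[of i x] \<zeta>_between[of i] by auto
  next
    case False
    then obtain k where k: "i = Suc k" "x = v i"
      using x by (cases i) auto
    then have "s x = poly (L i) x"
      using i s[of k x] \<zeta>_between[of k] by auto
    moreover have "poly (L i) (v i) = poly (R i) (v i)"
      using ag[of i] i unfolding agree_at_def by (metis funpow_0 le0 less_imp_le)
    ultimately show ?thesis using k by simp
  qed
  moreover have "s x = poly (L (Suc i)) x" if i: "i < n" and x: "x \<in> {\<zeta> i..v (Suc i)}" for i x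
    using i x s[of i x] \<zeta>_between[of i] ag1[of i, unfolded agree_at_1_iff]
    by (cases "x = \<zeta> i") auto
  moreover have "s \<in> {v 0..v n} \<rightarrow>\<^sub>E UNIV" by (simp add: s_def)
  ultimately have "has_pieces s L R"
    unfolding has_pieces_def using deg ag ag1 by simp
  then show ?thesis by blast
qed

text \<open>Both pieces at \<open>v i\<close> share the part \<open>T i\<close>, so smoothness there
  holds whatever multiples of the power are added. Each split point thus has two coefficients of its
  own, and the systems decouple.\<close>

lemma spline_hermite_exists:
  fixes c :: "nat \<Rightarrow> nat \<Rightarrow> real"
  shows "\<exists>s\<in>spline_space n v \<zeta> \<phi>. \<forall>i\<le>n. \<forall>j\<le>\<phi> i - 1. vertex_deriv n v \<zeta> s j i = c i j"
proof -
  let ?P = "\<lambda>i. [:-v i, 1:] ^ \<phi> i"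
  have "\<exists>T. \<forall>a. degree (T + smult a (?P i)) \<le> \<phi> i \<and>
      (\<forall>j<\<phi> i. poly ((pderiv ^^ j) (T + smult a (?P i))) (v i) = c i j)" for i
    by (rule hermite_data_exists[where d = "\<phi> i" and v = "v i" and c = "c i"]) blast
  then obtain T where deg: "\<And>i a. degree (T i + smult a (?P i)) \<le> \<phi> i"
    and T: "\<And>i a j. j < \<phi> i \<Longrightarrow> poly ((pderiv ^^ j) (T i + smult a (?P i))) (v i) = c i j"
    by metis
  have "\<exists>a b. agree_at 1 (T i + smult a (?P i)) (T (Suc i) + smult b (?P (Suc i))) (\<zeta> i)"
    if "i < n" for i
    using \<zeta>_between[OF that] \<phi>_ge[of i] \<phi>_ge[of "Suc i"] that
    by (intro agree_at_1_add_powers_exists) auto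
  then obtain a b where ab: "\<And>i. i < n \<Longrightarrow>
      agree_at 1 (T i + smult (a i) (?P i)) (T (Suc i) + smult (b i) (?P (Suc i))) (\<zeta> i)"
    by metis
  \<comment> \<open>\<open>a\<close> and \<open>b\<close> are indexed by split points, hence the
    shift. At \<open>i = 0\<close> truncated subtraction gives \<open>b 0\<close>; any value serves,
    since no interval ends at \<open>v 0\<close>.\<close>
  define L where "L i = T i + smult (b (i - 1)) (?P i)" for i
  define R where "R i = T i + smult (a i) (?P i)" for i
  have lt: "j < \<phi> i" if "j \<le> \<phi> i - 1" "i \<le> n" for i j
    using that \<phi>_ge[of i] by simp
  have "\<exists>s. has_pieces s L R"
  proof (rule has_pieces_exists)
    show "agree_at (\<phi> i - 1) (L i) (R i) (v i)" if "i \<le> n" for i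
      unfolding agree_at_def L_def R_def using T lt that by simp
    show "agree_at 1 (R i) (L (Suc i)) (\<zeta> i)" if "i < n" for i
      using ab[OF that] by (simp add: L_def R_def)
  qed (simp add: L_def R_def deg)
  then obtain s where s: "has_pieces s L R" by blast
  have "vertex_deriv n v \<zeta> s j i = c i j" if "i \<le> n" "j \<le> \<phi> i - 1" for i j
    using that lt[of j i] T[of j i] vertex_piece_eq[OF s, of i]
    by (cases "i = n") (simp_all add: vertex_deriv_def L_def R_def)
  then show ?thesis
    using spline_space_if_has_pieces[OF s] by blast
qed

lemma spline_hermite_unique:
  assumes s: "s \<in> spline_space n v \<zeta> \<phi>" and t: "t \<in> spline_space n v \<zeta> \<phi>"
    and eq: "\<And>i j. i \<le> n \<Longrightarrow> j \<le> \<phi> i - 1 \<Longrightarrow> vertex_deriv n v \<zeta> s j i = vertex_deriv n v \<zeta> t j i"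
  shows "s = t"
proof
  fix x
  obtain L R where p: "has_pieces s L R" using s spline_space_iff by blast
  obtain L' R' where p': "has_pieces t L' R'" using t spline_space_iff by blast
  have R: "poly ((pderiv ^^ j) (R i)) (v i) = poly ((pderiv ^^ j) (R' i)) (v i)"
    if "i < n" "j < \<phi> i" for i j
    using eq[of i j] that vertex_piece_eq[OF p, of i] vertex_piece_eq[OF p', of i]
    by (simp add: vertex_deriv_def)
  \<comment> \<open>At an interior vertex the data are read from the right-hand piece; smoothness of
    order \<open>\<phi> i - 1\<close> carries them over to the left-hand one.\<close>
  have L: "poly ((pderiv ^^ j) (L i)) (v i) = poly ((pderiv ^^ j) (L' i)) (v i)"
    if "0 < i" "i \<le> n" "j < \<phi> i" for i j
  proof (cases "i = n")
    case True
    then show ?thesis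
      using eq[of i j] that vertex_piece_eq[OF p, of i] vertex_piece_eq[OF p', of i]
      by (simp add: vertex_deriv_def)
  next
    case False
    then have i: "i < n" "j \<le> \<phi> i - 1" using that by simp_all
    have "agree_at (\<phi> i - 1) (L i) (R i) (v i)" "agree_at (\<phi> i - 1) (L' i) (R' i) (v i)"
      using p p' i that by (simp_all add: has_pieces_def)
    then show ?thesis
      using R[of i j] i that by (simp add: agree_at_def)
  qed
  have pieces: "R i = R' i \<and> L (Suc i) = L' (Suc i)" if i: "i < n" for i
  proof -
    obtain a where a: "R i = R' i + smult a ([:-v i, 1:] ^ \<phi> i)"
      by (rule hermite_data_eq_imp[of "R i" "\<phi> i" "R' i" "v i"])
         (use p p' R i in \<open>simp_all add: has_pieces_def\<close>)
    obtain b where b: "L (Suc i) = L' (Suc i) + smult b ([:-v (Suc i), 1:] ^ \<phi> (Suc i))"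
      by (rule hermite_data_eq_imp[of "L (Suc i)" "\<phi> (Suc i)" "L' (Suc i)" "v (Suc i)"])
         (use p p' L i in \<open>simp_all add: has_pieces_def\<close>)
    have "a = 0 \<and> b = 0"
    proof (rule agree_at_1_add_powers_unique)
      show "agree_at 1 (R' i) (L' (Suc i)) (\<zeta> i)"
        using p' i by (simp add: has_pieces_def)
      show "agree_at 1 (R' i + smult a ([:-v i, 1:] ^ \<phi> i))
          (L' (Suc i) + smult b ([:-v (Suc i), 1:] ^ \<phi> (Suc i))) (\<zeta> i)"
        using p i unfolding a[symmetric] b[symmetric] by (simp add: has_pieces_def)
    qed (use \<zeta>_between[OF i] \<phi>_ge[of i] \<phi>_ge[of "Suc i"] i in auto)
    then show ?thesis using a b by simp
  qed
  show "s x = t x"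
  proof (cases "x \<in> {v 0..v n}")
    case True
    then obtain i where i: "i < n" "x \<in> {v i..v (Suc i)}" by (rule obtain_cell)
    then show ?thesis
      using p p' pieces[of i] by (cases "x \<le> \<zeta> i") (simp_all add: has_pieces_def)
  next
    case False
    then show ?thesis
      using s t by (auto simp: spline_space_def PiE_iff extensional_def)
  qed
qed

section \<open>B-spline-like functions and the quasi-interpolant\<close>

lemma bspline_like_spec:
  assumes "i \<le> n"
  shows "bspline_like n v \<zeta> \<phi> i \<alpha> \<in> spline_space n v \<zeta> \<phi>"
    and "k \<le> n \<Longrightarrow> j \<le> \<phi> k - 1 \<Longrightarrow> vertex_deriv n v \<zeta> (bspline_like n v \<zeta> \<phi> i \<alpha>) j k =
      (if k = i then gamma_coeff n v \<zeta> \<phi> i \<alpha> j else 0)"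
proof -
  let ?P = "\<lambda>s. s \<in> spline_space n v \<zeta> \<phi> \<and>
       (\<forall>j\<le>\<phi> i - 1. vertex_deriv n v \<zeta> s j i = gamma_coeff n v \<zeta> \<phi> i \<alpha> j) \<and>
       (\<forall>k\<le>n. k \<noteq> i \<longrightarrow> (\<forall>j\<le>\<phi> k - 1. vertex_deriv n v \<zeta> s j k = 0))"
  have "\<exists>s. ?P s"
    using spline_hermite_exists[of "\<lambda>k j. if k = i then gamma_coeff n v \<zeta> \<phi> i \<alpha> j else 0"] assms
    by auto
  moreover have "s = t" if "?P s" "?P t" for s t
  proof (rule spline_hermite_unique)
    show "vertex_deriv n v \<zeta> s j k = vertex_deriv n v \<zeta> t j k" if "k \<le> n" "j \<le> \<phi> k - 1" for k j
      using \<open>?P s\<close> \<open>?P t\<close> that by (cases "k = i") auto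
  qed (use that in auto)
  \<comment> \<open>Unique solvability of Hermite interpolation gives the definite description its
    meaning.\<close>
  ultimately have "\<exists>!s. ?P s" by (rule ex_ex1I)
  then have "?P (bspline_like n v \<zeta> \<phi> i \<alpha>)"
    unfolding bspline_like_def by (rule theI'[of ?P])
  then show "bspline_like n v \<zeta> \<phi> i \<alpha> \<in> spline_space n v \<zeta> \<phi>"
    and "k \<le> n \<Longrightarrow> j \<le> \<phi> k - 1 \<Longrightarrow> vertex_deriv n v \<zeta> (bspline_like n v \<zeta> \<phi> i \<alpha>) j k =
      (if k = i then gamma_coeff n v \<zeta> \<phi> i \<alpha> j else 0)"
    by auto
qed

text \<open>A single sum over a finite index set is the form to which the lemmas on linear
  combinations of splines apply.\<close>

lemma quasi_interpolant_alt:
  "quasi_interpolant n v \<zeta> \<phi> p =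
    (\<lambda>x\<in>{v 0..v n}. \<Sum>(i, \<alpha>)\<in>(SIGMA i:{..n}. multi_indices (\<phi> i - 1)).
       blossom (\<phi> i) (vertex_piece n v \<zeta> p i)
         (v i # replicate (fst \<alpha>) (zeta_left v \<zeta> i) @ replicate (snd \<alpha>) (zeta_right n v \<zeta> i)) *
       bspline_like n v \<zeta> \<phi> i \<alpha> x)"
  unfolding quasi_interpolant_def by (subst sum.Sigma) auto

lemma quasi_interpolant_in_spline_space: "quasi_interpolant n v \<zeta> \<phi> p \<in> spline_space n v \<zeta> \<phi>"
  unfolding quasi_interpolant_alt case_prod_unfold
  by (rule spline_space_sum) (auto intro: bspline_like_spec)

text \<open>B-spline-like functions of other vertices have zero data at \<open>v k\<close>, so only
  the terms with \<open>i = k\<close> survive.\<close>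

lemma vertex_deriv_quasi_interpolant:
  assumes "k \<le> n" "j \<le> \<phi> k - 1"
  shows "vertex_deriv n v \<zeta> (quasi_interpolant n v \<zeta> \<phi> p) j k =
    (\<Sum>\<alpha>\<in>multi_indices (\<phi> k - 1).
       blossom (\<phi> k) (vertex_piece n v \<zeta> p k)
         (v k # replicate (fst \<alpha>) (zeta_left v \<zeta> k) @ replicate (snd \<alpha>) (zeta_right n v \<zeta> k)) *
       gamma_coeff n v \<zeta> \<phi> k \<alpha> j)" (is "_ = (\<Sum>\<alpha>\<in>_. ?b k \<alpha> * _)")
proof -
  have "vertex_deriv n v \<zeta> (quasi_interpolant n v \<zeta> \<phi> p) j k =
    (\<Sum>a\<in>(SIGMA i:{..n}. multi_indices (\<phi> i - 1)).
       ?b (fst a) (snd a) * vertex_deriv n v \<zeta> (bspline_like n v \<zeta> \<phi> (fst a) (snd a)) j k)"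
    unfolding quasi_interpolant_alt case_prod_unfold
    using assms(1) by (intro vertex_deriv_sum) (auto intro: bspline_like_spec)
  also have "\<dots> = (\<Sum>i\<le>n. \<Sum>\<alpha>\<in>multi_indices (\<phi> i - 1).
       ?b i \<alpha> * vertex_deriv n v \<zeta> (bspline_like n v \<zeta> \<phi> i \<alpha>) j k)"
    by (subst sum.Sigma) (auto simp: case_prod_unfold)
  also have "\<dots> = (\<Sum>i\<le>n. if k = i then \<Sum>\<alpha>\<in>multi_indices (\<phi> i - 1).
       ?b i \<alpha> * gamma_coeff n v \<zeta> \<phi> i \<alpha> j else 0)"
    using assms by (intro sum.cong refl) (auto simp: bspline_like_spec)
  finally show ?thesis using assms(1) by simp
qed

text \<open>The degree bound makes the polynomial itself a spline, so equality follows from equal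
  Hermite data, which \<open>vertex_reproduction\<close> supplies at each vertex.\<close>

lemma quasi_interpolant_poly:
  assumes "\<And>i. i \<le> n \<Longrightarrow> degree q \<le> \<phi> i"
  shows "quasi_interpolant n v \<zeta> \<phi> (\<lambda>x\<in>{v 0..v n}. poly q x) = (\<lambda>x\<in>{v 0..v n}. poly q x)"
    (is "_ = ?q")
proof (rule spline_hermite_unique)
  have pc: "has_pieces ?q (\<lambda>_. q) (\<lambda>_. q)"
    using assms by (rule has_pieces_poly)
  show "?q \<in> spline_space n v \<zeta> \<phi>"
    using pc by (rule spline_space_if_has_pieces)
  fix i j assume ij: "i \<le> n" "j \<le> \<phi> i - 1"
  have vp: "vertex_piece n v \<zeta> ?q i = q"
    using vertex_piece_eq[OF pc ij(1)] by simp
  define m where "m = \<phi> i - 1"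
  have m: "\<phi> i = Suc m" "m \<ge> 1" using \<phi>_ge[OF ij(1)] by (auto simp: m_def)
  \<comment> \<open>Nonzero because \<open>\<phi> i \<ge> 2\<close>, that is
    \<open>m \<ge> 1\<close>.\<close>
  have "theta \<phi> i \<noteq> 0" using m by (simp add: theta_def)
  then have "vertex_deriv n v \<zeta> (quasi_interpolant n v \<zeta> \<phi> ?q) j i = poly ((pderiv ^^ j) q) (v i)"
    using vertex_reproduction[where m = m and q = q and l = "zeta_left v \<zeta> i" and v = "v i"
        and r = "zeta_right n v \<zeta> i" and \<theta> = "theta \<phi> i" and j = j]
      zeta_left_less_zeta_right[OF ij(1)] assms[OF ij(1)] ij m
    unfolding vertex_deriv_quasi_interpolant[OF ij] vp gamma_coeff_def S_left_def S_right_def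
    by simp
  then show "vertex_deriv n v \<zeta> (quasi_interpolant n v \<zeta> \<phi> ?q) j i = vertex_deriv n v \<zeta> ?q j i"
    by (simp add: vertex_deriv_def vp)
qed (rule quasi_interpolant_in_spline_space)

end

theorem proposition8:
  fixes n :: nat and a b :: real and v \<zeta> :: "nat \<Rightarrow> real" and \<phi> :: "nat \<Rightarrow> nat"
  assumes "n \<ge> 1"
    and "v 0 = a" and "v n = b"
    and "\<And>i. i < n \<Longrightarrow> v i < v (Suc i)"
    and "\<And>i. i < n \<Longrightarrow> \<zeta> i \<in> {v i<..<v (Suc i)}"
    and "\<And>i. i \<le> n \<Longrightarrow> \<phi> i \<ge> 2"
  shows "(\<forall>p\<in>pw_polys n v \<zeta> \<phi>. quasi_interpolant n v \<zeta> \<phi> p \<in> spline_space n v \<zeta> \<phi>) \<and>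
    (\<forall>q\<in>polys_upto (Min (\<phi> ` {0..n})). \<forall>x\<in>{a..b}.
       quasi_interpolant n v \<zeta> \<phi> (\<lambda>t\<in>{a..b}. poly q t) x = poly q x)"
proof -
  interpret split_partition n v \<zeta> \<phi>
    using assms by unfold_locales auto
  have "quasi_interpolant n v \<zeta> \<phi> (\<lambda>t\<in>{a..b}. poly q t) x = poly q x"
    if "q \<in> polys_upto (Min (\<phi> ` {0..n}))" "x \<in> {a..b}" for q x
  proof -
    have "degree q \<le> \<phi> i" if "i \<le> n" for i
      using \<open>q \<in> _\<close> that by (auto simp: polys_upto_def)
    then show ?thesis
      using quasi_interpolant_poly[of q] that(2) assms(2,3) by simp
  qed
  then show ?thesis
    using quasi_interpolant_in_spline_space by blast
qed

end
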